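(* Let $\kappa$ be a regular uncountable cardinal with $\kappa^{<\kappa}>\kappa$. Let $\mathbb P$ be the set of pairs $p=(x_p,f_p)$ with $x_p\in[\kappa^+]^{<\kappa}$ and $f_p$ a function with $|f_p|<\kappa$, $\mathrm{dom}(f_p)\subseteq x_p\times\kappa$, and $f_p(\beta,\eta)\subseteq\beta\cap x_p$ for all $(\beta,\eta)\in\mathrm{dom}(f_p)$; order $q\le p$ iff $x_q\supseteq x_p$ and $f_q\supseteq f_p$; let $\mathbb Q=\{p\in\mathbb P\mid x_p=\mathrm{cl}(x_p)\}$; for a c.o.i. $\pi$ from a subset of $\kappa^+$ to $\kappa^+$ and $p$ with $x_p\subseteq\mathrm{dom}(\pi)$, let $\pi.p=(\pi[x_p],\{((\pi(\beta),\eta),\pi[z])\mid((\beta,\eta),z)\in f_p\})$; and let $p\restriction\alpha=(x_p\cap\alpha,\{((\beta,\eta),z)\in f_p\mid\beta<\alpha\})$. Then $(\mathbb P,\le,\mathbb Q)$ (with realm $x_p$, these actions and these restrictions) witnesses the failure of $\mathrm{FA}_\kappa$: there is a collection of $\kappa$ sharply dense systems for it such that no filter on $\mathbb P$ meets all of them everywhere.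
   Context: A c.o.i. is an order-preserving injective continuous map from a set of ordinals, closed in its supremum, into the ordinals; $\binom{\mu}{\theta}$ is the set of images of c.o.i.'s $\pi:\theta\to\mu$. $\mathrm{cl}(x)=x\cup\{\alpha<\sup\{\gamma+1\mid\gamma\in x\}\mid\sup(x\cap\alpha)=\alpha>0\}$. The triple above belongs to the class $\mathcal P_\kappa$ of the paper (forcing notions with realms, c.o.i.-actions and restrictions satisfying the axioms of that class). For such a triple: a nonempty $D\subseteq\mathbb P$ is sharply dense if, with $x_D=\bigcap_{p\in D}x_p$, every $p$ has $q\in D$, $q\le p$, with $x_q=\mathrm{cl}(x_p\cup x_D)$; a sharply dense system is a family $\{D_x\mid x\in\binom{\kappa^+}{\theta}\}$ for some ordinal $\theta<\kappa$ with each $D_x$ sharply dense, $x_{D_x}=x$, and $p\in D_x\iff\pi.p\in D_{\pi[x]}$ for every $p$ and c.o.i. $\pi:y\to\kappa^+$ with $x\subseteq x_p\subseteq y$. A filter $G$ meets a system everywhere if it meets each of its members. $\mathrm{FA}_\kappa$ asserts that for every triple in $\mathcal P_\kappa$ and every $\kappa$ sharply dense systems there is a filter meeting all of them everywhere. *)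

theory Defs
  imports Main
begin

unbundle cardinal_syntax

(* Ordinals are the elements of a type of class wellorder, each alpha standing for the set {..<alpha}
   of its predecessors; the type is arbitrary apart from containing the ordinals that occur in a
   statement. ord_rel alpha is the membership order of alpha in the form expected by the library's
   cardinals (a reflexive relation with field {..<alpha}). *)

definition ord_rel :: "'o::wellorder \<Rightarrow> 'o rel" where
  "ord_rel \<alpha> = {(\<beta>, \<gamma>). \<beta> \<le> \<gamma> \<and> \<gamma> < \<alpha>}"

lemma Field_ord_rel: "Field (ord_rel \<alpha>) = {..<\<alpha>}"
  by (auto simp: ord_rel_def Field_def)

lemma Well_order_ord_rel: "Well_order (ord_rel \<alpha>)"
proof -
  have "Linear_order (ord_rel \<alpha>)"
    unfolding order_on_defs Field_ord_rel refl_on_def trans_def antisym_def total_on_def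
    by (auto simp: ord_rel_def)
  moreover have "wf (ord_rel \<alpha> - Id)"
    by (rule wf_subset[OF wf]) (auto simp: ord_rel_def)
  ultimately show ?thesis
    by (simp add: well_order_on_def)
qed

definition regular_uncountable :: "'o::wellorder \<Rightarrow> bool" where
  "regular_uncountable \<kappa> \<longleftrightarrow>
     Card_order (ord_rel \<kappa>) \<and> natLeq <o ord_rel \<kappa> \<and> regularCard (ord_rel \<kappa>)"

definition is_succ_card :: "'o::wellorder \<Rightarrow> 'o \<Rightarrow> bool" where
  "is_succ_card \<kappa>' \<kappa> \<longleftrightarrow> ord_rel \<kappa>' =o cardSuc (ord_rel \<kappa>)"

(* The functions from some alpha < kappa to kappa; partial maps are used so that functions with
   different domains are different. Its cardinality is kappa^{<kappa}. *)
definition short_seqs :: "'o::wellorder \<Rightarrow> ('o \<rightharpoonup> 'o) set" where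
  "short_seqs \<kappa> = {s. \<exists>\<alpha><\<kappa>. dom s = {..<\<alpha>} \<and> ran s \<subseteq> {..<\<kappa>}}"

(* The next three are meaningful where the least element exists; osup in particular is only applied
   to bounded sets. The supremum of the empty set is 0. *)
definition ozero :: "'o::wellorder" where
  "ozero = (LEAST \<alpha>. True)"

definition osuc :: "'o::wellorder \<Rightarrow> 'o" where
  "osuc \<gamma> = (LEAST \<alpha>. \<gamma> < \<alpha>)"

definition osup :: "'o::wellorder set \<Rightarrow> 'o" where
  "osup x = (LEAST \<alpha>. \<forall>\<gamma>\<in>x. \<gamma> \<le> \<alpha>)"

definition limit_point :: "'o::wellorder set \<Rightarrow> 'o \<Rightarrow> bool" where
  "limit_point x \<alpha> \<longleftrightarrow> osup (x \<inter> {..<\<alpha>}) = \<alpha> \<and> ozero < \<alpha>"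

definition cl :: "'o::wellorder set \<Rightarrow> 'o set" where
  "cl x = x \<union> {\<alpha>. \<alpha> < osup (osuc ` x) \<and> limit_point x \<alpha>}"

definition closed_in_sup :: "'o::wellorder set \<Rightarrow> bool" where
  "closed_in_sup y \<longleftrightarrow> (\<forall>\<alpha> < osup y. limit_point y \<alpha> \<longrightarrow> \<alpha> \<in> y)"

(* A c.o.i. is given by its domain y and a function of which only the values on y matter. Since y is
   closed in its supremum, continuity for the order topology amounts to commuting with suprema at
   those limit points of y that lie in y. *)
definition coi :: "'o::wellorder set \<Rightarrow> ('o \<Rightarrow> 'o) \<Rightarrow> bool" where
  "coi y \<pi> \<longleftrightarrow> closed_in_sup y \<and> strict_mono_on y \<pi> \<and>
     (\<forall>\<alpha>\<in>y. limit_point y \<alpha> \<longrightarrow> \<pi> \<alpha> = osup (\<pi> ` (y \<inter> {..<\<alpha>})))"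

definition coi_images :: "'o::wellorder \<Rightarrow> 'o \<Rightarrow> 'o set set" where
  "coi_images \<mu> \<theta> = {\<pi> ` {..<\<theta>} | \<pi>. coi {..<\<theta>} \<pi> \<and> \<pi> ` {..<\<theta>} \<subseteq> {..<\<mu>}}"

(* A triple (conds, le, core) with its realms, c.o.i.-action and restrictions; action pi p is used
   only for c.o.i.'s pi whose domain includes the realm of p. *)
record ('o, 'p) realm_forcing =
  conds :: "'p set"
  le :: "'p \<Rightarrow> 'p \<Rightarrow> bool"
  core :: "'p set"
  realm :: "'p \<Rightarrow> 'o set"
  action :: "('o \<Rightarrow> 'o) \<Rightarrow> 'p \<Rightarrow> 'p"
  restr :: "'p \<Rightarrow> 'o \<Rightarrow> 'p"

definition common_realm :: "('o, 'p) realm_forcing \<Rightarrow> 'p set \<Rightarrow> 'o set" where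
  "common_realm T D = (\<Inter>p\<in>D. realm T p)"

definition sharply_dense :: "('o::wellorder, 'p) realm_forcing \<Rightarrow> 'p set \<Rightarrow> bool" where
  "sharply_dense T D \<longleftrightarrow> D \<noteq> {} \<and> D \<subseteq> conds T \<and>
     (\<forall>p \<in> conds T. \<exists>q \<in> D. le T q p \<and> realm T q = cl (realm T p \<union> common_realm T D))"

(* A system is the set of the D x; x is recovered from D x as its common realm. *)
definition sharply_dense_system ::
    "'o::wellorder \<Rightarrow> 'o \<Rightarrow> ('o, 'p) realm_forcing \<Rightarrow> 'p set set \<Rightarrow> bool" where
  "sharply_dense_system \<kappa> \<kappa>' T S \<longleftrightarrow>
     (\<exists>\<theta><\<kappa>. \<exists>D. S = D ` coi_images \<kappa>' \<theta> \<and>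
        (\<forall>x \<in> coi_images \<kappa>' \<theta>.
           sharply_dense T (D x) \<and> common_realm T (D x) = x \<and>
           (\<forall>p \<in> conds T. \<forall>y \<pi>.
              y \<subseteq> {..<\<kappa>'} \<and> coi y \<pi> \<and> \<pi> ` y \<subseteq> {..<\<kappa>'} \<and> x \<subseteq> realm T p \<and> realm T p \<subseteq> y \<longrightarrow>
              (p \<in> D x \<longleftrightarrow> action T \<pi> p \<in> D (\<pi> ` x)))))"

definition filter_on :: "('o, 'p) realm_forcing \<Rightarrow> 'p set \<Rightarrow> bool" where
  "filter_on T G \<longleftrightarrow> G \<noteq> {} \<and> G \<subseteq> conds T \<and>
     (\<forall>p \<in> G. \<forall>q \<in> conds T. le T p q \<longrightarrow> q \<in> G) \<and>
     (\<forall>p \<in> G. \<forall>q \<in> G. \<exists>r \<in> G. le T r p \<and> le T r q)"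

definition meets_everywhere :: "'p set \<Rightarrow> 'p set set \<Rightarrow> bool" where
  "meets_everywhere G S \<longleftrightarrow> (\<forall>D \<in> S. G \<inter> D \<noteq> {})"

(* A pair (x, f), with the function f given as its set of pairs. *)
type_synonym 'o cond = "'o set \<times> (('o \<times> 'o) \<times> 'o set) set"

definition P_conds :: "'o::wellorder \<Rightarrow> 'o \<Rightarrow> 'o cond set" where
  "P_conds \<kappa> \<kappa>' = {(x, f). x \<subseteq> {..<\<kappa>'} \<and> |x| <o ord_rel \<kappa> \<and>
     single_valued f \<and> |f| <o ord_rel \<kappa> \<and> Domain f \<subseteq> x \<times> {..<\<kappa>} \<and>
     (\<forall>\<beta> \<eta> z. ((\<beta>, \<eta>), z) \<in> f \<longrightarrow> z \<subseteq> {..<\<beta>} \<inter> x)}"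

definition P_triple :: "'o::wellorder \<Rightarrow> 'o \<Rightarrow> ('o, 'o cond) realm_forcing" where
  "P_triple \<kappa> \<kappa>' =
     \<lparr>conds = P_conds \<kappa> \<kappa>',
      le = (\<lambda>q p. fst p \<subseteq> fst q \<and> snd p \<subseteq> snd q),
      core = {p \<in> P_conds \<kappa> \<kappa>'. fst p = cl (fst p)},
      realm = fst,
      action = (\<lambda>\<pi> p. (\<pi> ` fst p, {((\<pi> \<beta>, \<eta>), \<pi> ` z) | \<beta> \<eta> z. ((\<beta>, \<eta>), z) \<in> snd p})),
      restr = (\<lambda>p \<alpha>. (fst p \<inter> {..<\<alpha>}, {((\<beta>, \<eta>), z) | \<beta> \<eta> z. ((\<beta>, \<eta>), z) \<in> snd p \<and> \<beta> < \<alpha>}))\<rparr>"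

end

theory Submission
  imports Defs
begin

text \<open>
  Since \<open>\<kappa>\<close> is infinite and \<open>\<kappa>\<^sup><\<^sup>\<kappa> > \<kappa>\<close>, some \<open>\<rho> < \<kappa>\<close> has more than \<open>\<kappa>\<close> functions
  \<open>s : \<rho> \<rightarrow> \<kappa>\<close>. For a closed set \<open>x\<close> of type \<open>\<rho> + 2\<close> with maximum \<open>\<beta>\<close>, let \<open>D\<^sub>x\<close> consist
  of the conditions \<open>p\<close> with \<open>x \<subseteq> x\<^sub>p\<close> and \<open>f\<^sub>p(\<beta>, \<eta>) = x \<inter> \<beta>\<close> for some \<open>\<eta> \<ge> \<xi>\<close>; the parameter
  \<open>\<xi> < \<kappa>\<close> only serves to have \<open>\<kappa>\<close> many systems. A filter that meets one of these systems
  everywhere enumerates, by \<open>\<eta> \<mapsto> f\<^sub>p(\<kappa>, \<eta>)\<close>, the closed sets of type \<open>\<rho> + 2\<close> with maximum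
  \<open>\<kappa>\<close>, so there are at most \<open>\<kappa>\<close> of them. But each \<open>s\<close> can be coded into such a set, by letting
  the successor steps of its increasing enumeration depend on the values of \<open>s\<close>.
\<close>

section \<open>Suprema, successors and closures of sets of ordinals\<close>

text \<open>\<open>LEAST\<close> is meaningful only where an upper bound exists, and
  \<open>u\<close> supplies one.\<close>

lemma le_osup: "(\<And>\<gamma>. \<gamma> \<in> x \<Longrightarrow> \<gamma> \<le> u) \<Longrightarrow> \<gamma> \<in> x \<Longrightarrow> \<gamma> \<le> osup x"
  for x :: "'o::wellorder set"
  unfolding osup_def by (rule LeastI2[where a = u]) auto

lemma osup_le: "(\<And>\<gamma>. \<gamma> \<in> x \<Longrightarrow> \<gamma> \<le> u) \<Longrightarrow> osup x \<le> u"
  for x :: "'o::wellorder set"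
  unfolding osup_def by (rule Least_le) auto

lemma less_osupD: "\<alpha> < osup x \<Longrightarrow> \<exists>\<gamma>\<in>x. \<alpha> < \<gamma>"
  for x :: "'o::wellorder set"
  using osup_le[of x \<alpha>] by (meson leD leI)

text \<open>The type may have a greatest element, so \<delta> witnesses that something lies above
  \<gamma>.\<close>

lemma less_osuc: "\<gamma> < \<delta> \<Longrightarrow> \<gamma> < osuc \<gamma>"
  for \<gamma> :: "'o::wellorder"
  unfolding osuc_def by (rule LeastI)

lemma osuc_le: "\<gamma> < \<delta> \<Longrightarrow> osuc \<gamma> \<le> \<delta>"
  for \<gamma> :: "'o::wellorder"
  unfolding osuc_def by (rule Least_le)

lemma less_osucD: "\<alpha> < osuc \<gamma> \<Longrightarrow> \<alpha> \<le> \<gamma>"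
  for \<gamma> :: "'o::wellorder"
  using osuc_le[of \<gamma> \<alpha>] by (meson leD leI)

lemma lessThan_osuc: "\<gamma> < \<delta> \<Longrightarrow> {..<osuc \<gamma>} = {..\<gamma>}"
  for \<gamma> :: "'o::wellorder"
  using less_osuc[of \<gamma> \<delta>] less_osucD[of _ \<gamma>] by auto

lemma closed_in_sup_lessThan: "closed_in_sup {..<\<theta>}"
  for \<theta> :: "'o::wellorder"
  unfolding closed_in_sup_def by (auto dest!: less_osupD intro: less_trans)

lemma cl_superset: "x \<subseteq> cl x"
  by (simp add: cl_def)

lemma cl_lessThan:
  fixes \<mu> :: "'o::wellorder"
  assumes "x \<subseteq> {..<\<mu>}"
  shows "cl x \<subseteq> {..<\<mu>}"
proof -
  have "osup (osuc ` x) \<le> \<mu>"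
    using assms by (intro osup_le) (auto intro: osuc_le)
  then show ?thesis
    using assms by (auto simp: cl_def)
qed

text \<open>A limit point of \<open>x\<close> is determined by the least element of \<open>x\<close> that is not below it.\<close>

lemma card_of_limit_points:
  fixes x :: "'o::wellorder set"
  shows "|{\<alpha>. \<alpha> < osup (osuc ` x) \<and> limit_point x \<alpha>}| \<le>o |x|"
proof -
  let ?L = "{\<alpha>. \<alpha> < osup (osuc ` x) \<and> limit_point x \<alpha>}"
  define nx where "nx \<alpha> = (LEAST \<gamma>. \<gamma> \<in> x \<and> \<alpha> \<le> \<gamma>)" for \<alpha>
  have nx: "nx \<alpha> \<in> x \<and> \<alpha> \<le> nx \<alpha>" if "\<alpha> \<in> ?L" for \<alpha>
  proof -
    obtain \<gamma> where "\<gamma> \<in> x" "\<alpha> \<le> \<gamma>"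
      using \<open>\<alpha> \<in> ?L\<close> by (auto dest!: less_osupD less_osucD)
    then show ?thesis
      unfolding nx_def by (intro LeastI[of "\<lambda>\<gamma>. \<gamma> \<in> x \<and> \<alpha> \<le> \<gamma>"]) simp
  qed
  have nx_le: "nx \<alpha> \<le> \<gamma>" if "\<gamma> \<in> x" "\<alpha> \<le> \<gamma>" for \<alpha> \<gamma>
    unfolding nx_def using that by (simp add: Least_le)
  have neq: "nx \<alpha> \<noteq> nx \<alpha>'" if "\<alpha> \<in> ?L" "\<alpha>' \<in> ?L" "\<alpha> < \<alpha>'" for \<alpha> \<alpha>'
  proof
    assume eq: "nx \<alpha> = nx \<alpha>'"
    \<comment> \<open>An element \<gamma> of \<open>x\<close> with \<alpha> \<le> \<gamma> <
      \<alpha>' would give \<open>nx \<alpha>\<close> \<le> \<gamma> < \<alpha>' \<le>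
      \<open>nx \<alpha>'\<close>. Hence \<open>x\<close> has the same part below both limit points,
      and each of them is the supremum of that part.\<close>
    have "x \<inter> {..<\<alpha>'} = x \<inter> {..<\<alpha>}"
      using nx_le[of _ \<alpha>] nx[OF that(2)] eq \<open>\<alpha> < \<alpha>'\<close> by (force simp: not_less[symmetric])
    then show False
      using that by (simp add: limit_point_def)
  qed
  have "inj_on nx ?L"
    using neq by (metis (lifting) inj_onI linorder_neqE)
  then show ?thesis
    using nx by (intro card_of_ordLeqI[of nx]) auto
qed

text \<open>By induction, both functions take at \<alpha> the least element of the common image that
  is not an earlier value. This recovers an enumeration from the bare set.\<close>

lemma strict_mono_on_image_unique:
  fixes f h :: "'o::wellorder \<Rightarrow> 'a::linorder"
  assumes f: "strict_mono_on {..<\<theta>} f" and h: "strict_mono_on {..<\<theta>} h"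
    and eq: "f ` {..<\<theta>} = h ` {..<\<theta>}" and "\<alpha> < \<theta>"
  shows "f \<alpha> = h \<alpha>"
  using \<open>\<alpha> < \<theta>\<close>
proof (induction \<alpha> rule: less_induct)
  case (less \<alpha>)
  have key: "h' \<alpha> \<le> f' \<alpha>"
    if "strict_mono_on {..<\<theta>} f'" "strict_mono_on {..<\<theta>} h'"
      and eq': "f' ` {..<\<theta>} = h' ` {..<\<theta>}" and "\<And>\<beta>. \<beta> < \<alpha> \<Longrightarrow> f' \<beta> = h' \<beta>" for f' h' :: "'o \<Rightarrow> 'a"
  proof -
    obtain \<beta> where \<beta>: "\<beta> < \<theta>" "f' \<alpha> = h' \<beta>"
      using eq' less.prems by blast
    have "\<not> \<beta> < \<alpha>"
      using that(1,4) \<beta> less.prems by (metis lessThan_iff less_irrefl strict_mono_onD)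
    then show ?thesis
      using that(2) \<beta> less.prems by (metis lessThan_iff not_less strict_mono_on_leD)
  qed
  show ?case
    using key[OF f h eq] key[OF h f eq[symmetric]] less by (metis less_trans order_antisym)
qed

section \<open>Cardinal arithmetic below \<kappa>\<close>

lemma card_of_lessThan: "Card_order (ord_rel \<kappa>) \<Longrightarrow> |{..<\<kappa>}| =o ord_rel \<kappa>"
  for \<kappa> :: "'o::wellorder"
  using card_of_Field_ordIso[of "ord_rel \<kappa>"] by (simp add: Field_ord_rel)

context
  fixes \<kappa> :: "'o::wellorder"
  assumes reg: "regular_uncountable \<kappa>"
begin

lemma Card_order_kappa: "Card_order (ord_rel \<kappa>)"
  using reg by (simp add: regular_uncountable_def)

lemma infinite_kappa: "\<not> finite (Field (ord_rel \<kappa>))"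
  using reg Card_order_kappa
  by (metis cinfinite_mono cinfinite_def natLeq_cinfinite ordLess_imp_ordLeq regular_uncountable_def)

lemma card_of_initial_less: "\<alpha> < \<kappa> \<Longrightarrow> |{..<\<alpha>}| <o ord_rel \<kappa>"
proof -
  assume "\<alpha> < \<kappa>"
  then have "underS (ord_rel \<kappa>) \<alpha> = {..<\<alpha>}"
    by (auto simp: underS_def ord_rel_def)
  then show ?thesis
    using card_of_underS[OF Card_order_kappa, of \<alpha>] \<open>\<alpha> < \<kappa>\<close> by (simp add: Field_ord_rel)
qed

lemma card_of_Un_less_kappa:
  "|A| <o ord_rel \<kappa> \<Longrightarrow> |B| <o ord_rel \<kappa> \<Longrightarrow> |A \<union> B| <o ord_rel \<kappa>"
  using card_of_Un_ordLess_infinite_Field[OF infinite_kappa Card_order_kappa] .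

lemma card_of_finite_less_kappa: "finite A \<Longrightarrow> |A| <o ord_rel \<kappa>"
  using finite_ordLess_infinite[of "|A|" "ord_rel \<kappa>"] infinite_kappa
  by (simp add: Well_order_ord_rel Field_card_of card_of_well_order_on)

lemma card_of_cl_less:
  assumes "|x| <o ord_rel \<kappa>"
  shows "|cl x| <o ord_rel \<kappa>"
  unfolding cl_def
  using assms ordLeq_ordLess_trans[OF card_of_limit_points assms] by (rule card_of_Un_less_kappa)

lemma tail_diff_large:
  assumes "\<xi> < \<kappa>" "|A| <o ord_rel \<kappa>"
  shows "|{..<\<kappa>}| \<le>o |{\<xi>..<\<kappa>} - A|"
proof (rule ccontr)
  assume "\<not> ?thesis"
  then have "|{\<xi>..<\<kappa>} - A| <o ord_rel \<kappa>"
    using card_of_lessThan[OF Card_order_kappa]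
    by (meson card_of_Well_order not_ordLess_iff_ordLeq ordLess_ordIso_trans)
  then have *: "|({\<xi>..<\<kappa>} - A) \<union> A \<union> {..<\<xi>}| <o ord_rel \<kappa>"
    using assms card_of_initial_less by (intro card_of_Un_less_kappa) auto
  have "|{..<\<kappa>}| \<le>o |({\<xi>..<\<kappa>} - A) \<union> A \<union> {..<\<xi>}|"
    by (rule card_of_mono1) auto
  then show False
    using * card_of_lessThan[OF Card_order_kappa]
    by (meson not_ordLess_ordIso ordIso_symmetric ordLeq_ordLess_trans)
qed

text \<open>This is regularity: a cofinal \<open>K\<close> would have cardinality \<kappa>.\<close>

lemma bounded_below_kappa:
  assumes "K \<subseteq> {..<\<kappa>}" "|K| <o ord_rel \<kappa>"
  shows "\<exists>u<\<kappa>. \<forall>b\<in>K. b \<le> u"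
proof -
  have "\<not> cofinal K (ord_rel \<kappa>)"
    using reg assms not_ordLess_ordIso
    unfolding regular_uncountable_def regularCard_def Field_ord_rel by blast
  then obtain u where u: "u < \<kappa>" "\<forall>b\<in>K. u = b \<or> (u, b) \<notin> ord_rel \<kappa>"
    unfolding cofinal_def Field_ord_rel by blast
  have "b \<le> u" if "b \<in> K" for b
  proof -
    have "b < \<kappa>"
      using that assms(1) by blast
    then show ?thesis
      using u(2) that by (cases b u rule: linorder_cases) (auto simp: ord_rel_def)
  qed
  then show ?thesis
    using u(1) by blast
qed

lemma osuc_less_kappa:
  assumes "\<alpha> < \<kappa>"
  shows "osuc \<alpha> < \<kappa>"
proof -
  have "|{..<\<kappa>}| \<le>o |{\<alpha>..<\<kappa>} - {\<alpha>}|"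
    using assms by (intro tail_diff_large card_of_finite_less_kappa) auto
  then have "{\<alpha>..<\<kappa>} - {\<alpha>} \<noteq> {}"
    using assms by (metis card_of_empty3 empty_iff lessThan_iff)
  then obtain \<beta> where "\<alpha> < \<beta>" "\<beta> < \<kappa>"
    by force
  then show ?thesis
    using osuc_le[of \<alpha> \<beta>] by auto
qed

text \<open>\<open>short_seqs \<kappa>\<close> is the union of these sets over \<kappa> many
  lengths; if each had size at most \<kappa>, so would the union.\<close>

lemma exists_long_seqs:
  assumes "ord_rel \<kappa> <o |short_seqs \<kappa>|"
  shows "\<exists>\<rho><\<kappa>. ord_rel \<kappa> <o |{s :: 'o \<rightharpoonup> 'o. dom s = {..<\<rho>} \<and> ran s \<subseteq> {..<\<kappa>}}|"
proof (rule ccontr)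
  let ?F = "\<lambda>\<rho>. {s :: 'o \<rightharpoonup> 'o. dom s = {..<\<rho>} \<and> ran s \<subseteq> {..<\<kappa>}}"
  assume "\<not> ?thesis"
  then have "\<forall>\<rho>\<in>{..<\<kappa>}. |?F \<rho>| \<le>o ord_rel \<kappa>"
    by (meson card_of_Well_order lessThan_iff not_ordLess_iff_ordLeq Well_order_ord_rel)
  then have "|\<Union>\<rho>\<in>{..<\<kappa>}. ?F \<rho>| \<le>o ord_rel \<kappa>"
    using card_of_lessThan[OF Card_order_kappa]
    by (intro card_of_UNION_ordLeq_infinite_Field[OF infinite_kappa Card_order_kappa])
      (auto intro: ordIso_imp_ordLeq)
  moreover have "(\<Union>\<rho>\<in>{..<\<kappa>}. ?F \<rho>) = short_seqs \<kappa>"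
    by (auto simp: short_seqs_def)
  ultimately show False
    using assms not_ordLess_ordLeq by fastforce
qed

end

section \<open>Coding sequences into closed sets\<close>

text \<open>The continuous function that starts at 0 and whose step from the value \<open>a\<close>
  at \<gamma> leads to \<open>g a (s \<gamma>)\<close>. For increasing steps the one supremum covers
  zero, successor and limit stages alike.\<close>

function coded :: "('o::wellorder \<Rightarrow> 'a \<Rightarrow> 'o) \<Rightarrow> ('o \<Rightarrow> 'a) \<Rightarrow> 'o \<Rightarrow> 'o" where
  "coded g s \<alpha> = osup ((\<lambda>\<gamma>. g (coded g s \<gamma>) (s \<gamma>)) ` {..<\<alpha>})"
  by auto
termination
  by (relation "inv_image {(\<alpha>, \<beta>). \<alpha> < \<beta>} (snd \<circ> snd)")
    (simp_all add: wf wf_inv_image)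

declare coded.simps [simp del]

context
  fixes \<kappa> \<rho> :: "'o::wellorder" and g :: "'o \<Rightarrow> 'o \<Rightarrow> 'o" and s :: "'o \<Rightarrow> 'o"
  assumes reg: "regular_uncountable \<kappa>" and rho: "\<rho> < \<kappa>"
    and g: "\<And>a b. a < \<kappa> \<Longrightarrow> b < \<kappa> \<Longrightarrow> a < g a b \<and> g a b < \<kappa>"
    and s: "\<And>\<gamma>. \<gamma> < \<rho> \<Longrightarrow> s \<gamma> < \<kappa>"
begin

text \<open>Each stage takes the supremum of fewer than \<kappa> ordinals below \<kappa>, so
  regularity applies.\<close>

lemma coded_less_kappa: "\<alpha> \<le> \<rho> \<Longrightarrow> coded g s \<alpha> < \<kappa>"
proof (induction \<alpha> rule: less_induct)
  case (less \<alpha>)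
  let ?K = "(\<lambda>\<gamma>. g (coded g s \<gamma>) (s \<gamma>)) ` {..<\<alpha>}"
  have "|?K| <o ord_rel \<kappa>"
    using less.prems rho card_of_image card_of_initial_less[OF reg] ordLeq_ordLess_trans
    by (meson le_less_trans)
  moreover have "?K \<subseteq> {..<\<kappa>}"
    using less g s by auto
  ultimately obtain u where "u < \<kappa>" "\<forall>b\<in>?K. b \<le> u"
    using bounded_below_kappa[OF reg] by blast
  then show ?case
    unfolding coded.simps[of g s \<alpha>] by (intro le_less_trans[OF osup_le[of ?K u]]) auto
qed

lemma step_le_coded:
  assumes "\<gamma> < \<alpha>" "\<alpha> \<le> \<rho>"
  shows "g (coded g s \<gamma>) (s \<gamma>) \<le> coded g s \<alpha>"
proof -
  have "g (coded g s \<delta>) (s \<delta>) \<le> \<kappa>" if "\<delta> < \<alpha>" for \<delta>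
    using that assms g[of "coded g s \<delta>" "s \<delta>"] coded_less_kappa[of \<delta>] s[of \<delta>] by auto
  then show ?thesis
    using assms unfolding coded.simps[of g s \<alpha>] by (intro le_osup[where u = \<kappa>]) auto
qed

lemma coded_strict_mono: "\<gamma> < \<alpha> \<Longrightarrow> \<alpha> \<le> \<rho> \<Longrightarrow> coded g s \<gamma> < coded g s \<alpha>"
  using g[of "coded g s \<gamma>" "s \<gamma>"] coded_less_kappa[of \<gamma>] s[of \<gamma>] step_le_coded[of \<gamma> \<alpha>] by auto

lemma coded_mono: "\<gamma> \<le> \<alpha> \<Longrightarrow> \<alpha> \<le> \<rho> \<Longrightarrow> coded g s \<gamma> \<le> coded g s \<alpha>"
  using coded_strict_mono by (auto simp: le_less)

text \<open>The step at \<gamma> is the largest one up to \<gamma>, because every earlier step is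
  already at most the value at \<gamma>. With \<open>g\<close> injective in its second argument,
  this equation allows \<open>s \<gamma>\<close> to be decoded.\<close>

lemma coded_osuc:
  assumes "\<gamma> < \<rho>"
  shows "coded g s (osuc \<gamma>) = g (coded g s \<gamma>) (s \<gamma>)"
proof (rule antisym)
  have "g (coded g s \<delta>) (s \<delta>) \<le> g (coded g s \<gamma>) (s \<gamma>)" if "\<delta> \<le> \<gamma>" for \<delta>
  proof (cases "\<delta> = \<gamma>")
    case False
    then have "g (coded g s \<delta>) (s \<delta>) \<le> coded g s \<gamma>"
      using that assms by (intro step_le_coded) auto
    also have "\<dots> \<le> g (coded g s \<gamma>) (s \<gamma>)"
      using g coded_less_kappa s assms by (simp add: less_imp_le)
    finally show ?thesis .
  qed simp
  then show "coded g s (osuc \<gamma>) \<le> g (coded g s \<gamma>) (s \<gamma>)"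
    unfolding coded.simps[of g s "osuc \<gamma>"] lessThan_osuc[OF assms] by (intro osup_le) auto
  show "g (coded g s \<gamma>) (s \<gamma>) \<le> coded g s (osuc \<gamma>)"
    using step_le_coded[OF less_osuc osuc_le] assms by blast
qed

text \<open>The recursion takes suprema of steps, continuity asks for suprema of values. At a limit
  these agree, since the step at \<gamma> is at most the value at any \<delta> between \<gamma> and
  \<alpha>.\<close>

lemma coded_limit:
  assumes lim: "limit_point {..<\<theta>} \<alpha>" and "\<alpha> \<le> \<rho>" "\<alpha> \<le> \<theta>"
  shows "coded g s \<alpha> = osup (coded g s ` {..<\<alpha>})"
proof (rule antisym)
  have le: "\<gamma> \<in> coded g s ` {..<\<alpha>} \<Longrightarrow> \<gamma> \<le> coded g s \<alpha>" for \<gamma>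
    using coded_mono \<open>\<alpha> \<le> \<rho>\<close> by auto
  then show "osup (coded g s ` {..<\<alpha>}) \<le> coded g s \<alpha>"
    by (rule osup_le)
  have "{..<\<theta>} \<inter> {..<\<alpha>} = {..<\<alpha>}"
    using \<open>\<alpha> \<le> \<theta>\<close> by auto
  then have sup: "osup {..<\<alpha>} = \<alpha>"
    using lim by (simp add: limit_point_def)
  have "g (coded g s \<gamma>) (s \<gamma>) \<le> osup (coded g s ` {..<\<alpha>})" if "\<gamma> < \<alpha>" for \<gamma>
  proof -
    obtain \<delta> where "\<gamma> < \<delta>" "\<delta> < \<alpha>"
      using less_osupD[of \<gamma> "{..<\<alpha>}"] sup \<open>\<gamma> < \<alpha>\<close> by auto
    then have "g (coded g s \<gamma>) (s \<gamma>) \<le> coded g s \<delta>"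
      using \<open>\<alpha> \<le> \<rho>\<close> by (intro step_le_coded) auto
    also have "\<dots> \<le> osup (coded g s ` {..<\<alpha>})"
      using le \<open>\<delta> < \<alpha>\<close> by (intro le_osup) auto
    finally show ?thesis .
  qed
  then show "coded g s \<alpha> \<le> osup (coded g s ` {..<\<alpha>})"
    unfolding coded.simps[of g s \<alpha>] by (intro osup_le) auto
qed

text \<open>The value \<open>\<kappa>\<close> at \<open>\<rho> + 1\<close> is admissible because \<open>\<rho> + 1\<close> is not a limit.\<close>

lemma coi_coded_top:
  shows "coi {..<osuc (osuc \<rho>)} (\<lambda>\<alpha>. if \<alpha> \<le> \<rho> then coded g s \<alpha> else \<kappa>)"
proof -
  have \<rho>1: "osuc \<rho> < \<kappa>"
    using osuc_less_kappa[OF reg rho] .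
  have dom: "{..<osuc (osuc \<rho>)} = insert (osuc \<rho>) {..\<rho>}"
    using lessThan_osuc[OF \<rho>1] lessThan_osuc[OF rho] by auto
  let ?\<pi> = "\<lambda>\<alpha>. if \<alpha> \<le> \<rho> then coded g s \<alpha> else \<kappa>"
  have "strict_mono_on {..<osuc (osuc \<rho>)} ?\<pi>"
    using less_osuc[OF rho] coded_less_kappa coded_strict_mono
    unfolding dom by (intro strict_mono_onI) auto
  moreover have "?\<pi> \<alpha> = osup (?\<pi> ` ({..<osuc (osuc \<rho>)} \<inter> {..<\<alpha>}))"
    if "\<alpha> < osuc (osuc \<rho>)" and lim: "limit_point {..<osuc (osuc \<rho>)} \<alpha>" for \<alpha>
  proof -
    have eq: "{..<osuc (osuc \<rho>)} \<inter> {..<\<alpha>} = {..<\<alpha>}"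
      using that by auto
    have "\<alpha> \<noteq> osuc \<rho>"
    proof
      assume "\<alpha> = osuc \<rho>"
      then have "osup {..\<rho>} = osuc \<rho>"
        using lim eq lessThan_osuc[OF rho] by (simp add: limit_point_def)
      moreover have "osup {..\<rho>} \<le> \<rho>"
        by (rule osup_le) simp
      ultimately show False
        using less_osuc[OF rho] by simp
    qed
    then have "\<alpha> \<le> \<rho>"
      using that dom by auto
    moreover have "?\<pi> ` {..<\<alpha>} = coded g s ` {..<\<alpha>}"
      using \<open>\<alpha> \<le> \<rho>\<close> by (intro image_cong) auto
    ultimately show ?thesis
      using coded_limit[OF lim] that by (simp add: eq)
  qed
  ultimately show ?thesis
    unfolding coi_def using closed_in_sup_lessThan by auto
qed

end

text \<open>The coding is injective: the set determines its increasing enumeration, and the values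
  at \<gamma> and \<gamma> + 1 determine \<open>s \<gamma>\<close>.\<close>

lemma many_closed_sets:
  fixes \<kappa> \<kappa>' \<rho> :: "'o::wellorder"
  assumes reg: "regular_uncountable \<kappa>" and "\<kappa> < \<kappa>'" and rho: "\<rho> < \<kappa>"
  shows "|{s :: 'o \<rightharpoonup> 'o. dom s = {..<\<rho>} \<and> ran s \<subseteq> {..<\<kappa>}}|
    \<le>o |{x \<in> coi_images \<kappa>' (osuc (osuc \<rho>)). \<kappa> \<in> x \<and> x \<subseteq> {..\<kappa>}}|"
proof -
  let ?F = "{s :: 'o \<rightharpoonup> 'o. dom s = {..<\<rho>} \<and> ran s \<subseteq> {..<\<kappa>}}"
  let ?\<theta> = "osuc (osuc \<rho>)"
  \<comment> \<open>\<open>g a\<close> will be an injection of \<kappa> into the ordinals strictly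
    between \<open>a\<close> and \<kappa>, so that a step from \<open>a\<close> can store any
    ordinal below \<kappa>.\<close>
  have "\<exists>h. inj_on h {..<\<kappa>} \<and> h ` {..<\<kappa>} \<subseteq> {a..<\<kappa>} - {a}" if "a < \<kappa>" for a
    using tail_diff_large[OF reg that card_of_finite_less_kappa[OF reg], of "{a}"]
    by (simp add: card_of_ordLeq)
  then obtain g where g_inj: "\<And>a. a < \<kappa> \<Longrightarrow> inj_on (g a) {..<\<kappa>}"
    and g_im: "\<And>a. a < \<kappa> \<Longrightarrow> g a ` {..<\<kappa>} \<subseteq> {a..<\<kappa>} - {a}"
    by metis
  have g: "a < g a b \<and> g a b < \<kappa>" if "a < \<kappa>" "b < \<kappa>" for a b
    using g_im[OF that(1)] that(2) by force
  \<comment> \<open>The top value \<kappa> gives all coded sets the same maximum. Up to \<rho> the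
    recursion reads \<open>s\<close> only below \<rho>, where \<open>the\<close> returns a genuine
    value.\<close>
  define \<pi> where "\<pi> s \<alpha> = (if \<alpha> \<le> \<rho> then coded g (\<lambda>\<gamma>. the (s \<gamma>)) \<alpha> else \<kappa>)"
    for s :: "'o \<rightharpoonup> 'o" and \<alpha>
  have val: "the (s \<gamma>) < \<kappa>" if "s \<in> ?F" "\<gamma> < \<rho>" for s \<gamma>
  proof -
    have "\<gamma> \<in> dom s"
      using that by auto
    then have "the (s \<gamma>) \<in> ran s"
      by (auto simp: ran_def)
    then show ?thesis
      using that by auto
  qed
  have less: "coded g (\<lambda>\<gamma>. the (s \<gamma>)) \<alpha> < \<kappa>" if "s \<in> ?F" "\<alpha> \<le> \<rho>" for s \<alpha>
    by (rule coded_less_kappa[OF reg rho]) (use g val[OF that(1)] that(2) in auto)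
  have coi: "coi {..<?\<theta>} (\<pi> s)" if "s \<in> ?F" for s
    unfolding \<pi>_def by (rule coi_coded_top[OF reg rho]) (use g val[OF that] in auto)
  have coded_osuc: "coded g (\<lambda>\<gamma>. the (s \<gamma>)) (osuc \<gamma>) = g (coded g (\<lambda>\<gamma>. the (s \<gamma>)) \<gamma>) (the (s \<gamma>))"
    if "s \<in> ?F" "\<gamma> < \<rho>" for s \<gamma>
    by (rule coded_osuc[OF reg rho]) (use g val[OF that(1)] that(2) in auto)
  have \<rho>1: "\<rho> < osuc \<rho>" "osuc \<rho> < ?\<theta>"
    using less_osuc[OF rho] less_osuc[OF osuc_less_kappa[OF reg rho]] .
  have "\<pi> s ` {..<?\<theta>} \<in> {x \<in> coi_images \<kappa>' ?\<theta>. \<kappa> \<in> x \<and> x \<subseteq> {..\<kappa>}}" if "s \<in> ?F" for s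
  proof -
    have "\<pi> s ` {..<?\<theta>} \<subseteq> {..\<kappa>}"
      using less[OF that] by (auto simp: \<pi>_def less_imp_le)
    moreover have "\<pi> s (osuc \<rho>) = \<kappa>"
      using \<rho>1(1) by (auto simp: \<pi>_def)
    then have "\<kappa> \<in> \<pi> s ` {..<?\<theta>}"
      using \<rho>1 by (metis imageI lessThan_iff)
    ultimately show ?thesis
      using coi[OF that] \<open>\<kappa> < \<kappa>'\<close> unfolding coi_images_def by force
  qed
  moreover have "inj_on (\<lambda>s. \<pi> s ` {..<?\<theta>}) ?F"
  proof (rule inj_onI)
    fix s t assume s: "s \<in> ?F" and t: "t \<in> ?F" and eq: "\<pi> s ` {..<?\<theta>} = \<pi> t ` {..<?\<theta>}"
    have "\<pi> s \<alpha> = \<pi> t \<alpha>" if "\<alpha> < ?\<theta>" for \<alpha>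
      using coi[OF s] coi[OF t] eq that
      by (intro strict_mono_on_image_unique[of ?\<theta>]) (auto simp: coi_def)
    then have coded_eq: "coded g (\<lambda>\<gamma>. the (s \<gamma>)) \<alpha> = coded g (\<lambda>\<gamma>. the (t \<gamma>)) \<alpha>" if "\<alpha> \<le> \<rho>" for \<alpha>
      using that \<rho>1 unfolding \<pi>_def by (metis (no_types, lifting) le_less_trans less_trans)
    have "s \<gamma> = t \<gamma>" for \<gamma>
    proof (cases "\<gamma> < \<rho>")
      case True
      have "g (coded g (\<lambda>\<gamma>. the (s \<gamma>)) \<gamma>) (the (s \<gamma>)) = g (coded g (\<lambda>\<gamma>. the (s \<gamma>)) \<gamma>) (the (t \<gamma>))"
        using coded_osuc[OF s True] coded_osuc[OF t True]
          coded_eq[of \<gamma>] coded_eq[OF osuc_le[OF True]] True by simp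
      then have "the (s \<gamma>) = the (t \<gamma>)"
        using inj_on_eq_iff[OF g_inj[OF less[OF s less_imp_le[OF True]]]] val[OF s True] val[OF t True]
        by simp
      moreover have "\<gamma> \<in> dom s" "\<gamma> \<in> dom t"
        using s t True by auto
      ultimately show ?thesis
        by (auto simp: dom_def)
    next
      case False
      then have "\<gamma> \<notin> dom s" "\<gamma> \<notin> dom t"
        using s t by auto
      then show ?thesis
        by (simp add: domIff)
    qed
    then show "s = t"
      by auto
  qed
  ultimately show ?thesis
    by (intro card_of_ordLeqI[of "\<lambda>s. \<pi> s ` {..<?\<theta>}"]) auto
qed

section \<open>The sharply dense systems\<close>

text \<open>The \<beta> is the maximum of \<open>x\<close>, so \<open>x - {\<beta>}\<close> is the
  part of \<open>x\<close> below \<beta>, an admissible value at \<beta>. Only order, membership and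
  entries of the condition occur, which a c.o.i. preserves.\<close>

definition guess :: "'o::wellorder \<Rightarrow> 'o \<Rightarrow> 'o \<Rightarrow> 'o set \<Rightarrow> 'o cond set" where
  "guess \<kappa> \<kappa>' \<xi> x = {p \<in> P_conds \<kappa> \<kappa>'. x \<subseteq> fst p \<and>
     (\<exists>\<beta>\<in>x. \<exists>\<eta>\<ge>\<xi>. x \<subseteq> {..\<beta>} \<and> ((\<beta>, \<eta>), x - {\<beta>}) \<in> snd p)}"

text \<open>The type is a successor, so the last point is enumerated at \<rho>.\<close>

lemma coi_images_max:
  fixes \<rho> :: "'o::wellorder"
  assumes "x \<in> coi_images \<mu> (osuc \<rho>)" "\<rho> < \<delta>"
  obtains \<beta> where "\<beta> \<in> x" "x \<subseteq> {..\<beta>}"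
proof -
  obtain \<pi> where \<pi>: "x = \<pi> ` {..\<rho>}" "strict_mono_on {..\<rho>} \<pi>"
    using assms lessThan_osuc[OF assms(2)] by (auto simp: coi_images_def coi_def)
  then have "\<pi> \<rho> \<in> x" "x \<subseteq> {..\<pi> \<rho>}"
    by (auto dest: strict_mono_on_leD)
  then show thesis
    by (rule that)
qed

lemma P_condsD:
  assumes p: "p \<in> P_conds \<kappa> \<kappa>'" and f: "((\<beta>, \<eta>), z) \<in> snd p"
  shows "\<beta> \<in> fst p" "\<eta> < \<kappa>" "z \<subseteq> {..<\<beta>} \<inter> fst p"
proof -
  have "(\<beta>, \<eta>) \<in> Domain (snd p)"
    using f by (rule DomainI)
  moreover have "Domain (snd p) \<subseteq> fst p \<times> {..<\<kappa>}"
    using p by (simp add: P_conds_def case_prod_beta)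
  ultimately show "\<beta> \<in> fst p" "\<eta> < \<kappa>"
    by auto
  show "z \<subseteq> {..<\<beta>} \<inter> fst p"
    using p f unfolding P_conds_def case_prod_beta by blast
qed

lemma P_conds_extend:
  fixes \<kappa> \<kappa>' :: "'o::wellorder"
  assumes reg: "regular_uncountable \<kappa>"
    and p: "(y, f) \<in> P_conds \<kappa> \<kappa>'" and "y \<subseteq> y'" "y' \<subseteq> {..<\<kappa>'}" "|y'| <o ord_rel \<kappa>"
    and "\<beta> \<in> y'" "\<eta> < \<kappa>" "(\<beta>, \<eta>) \<notin> Domain f" "z \<subseteq> {..<\<beta>} \<inter> y'"
  shows "(y', insert ((\<beta>, \<eta>), z) f) \<in> P_conds \<kappa> \<kappa>'"
proof -
  have "|insert ((\<beta>, \<eta>), z) f| <o ord_rel \<kappa>"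
    using card_of_Un_less_kappa[OF reg card_of_finite_less_kappa[OF reg], of "{((\<beta>, \<eta>), z)}" f] p
    by (simp add: P_conds_def)
  moreover have "single_valued (insert ((\<beta>, \<eta>), z) f)"
    using p \<open>(\<beta>, \<eta>) \<notin> Domain f\<close> by (auto simp: P_conds_def single_valued_def)
  moreover have "z' \<subseteq> {..<\<beta>'} \<inter> y'" if "((\<beta>', \<eta>'), z') \<in> insert ((\<beta>, \<eta>), z) f" for \<beta>' \<eta>' z'
  proof (cases "((\<beta>', \<eta>'), z') \<in> f")
    case True
    then show ?thesis
      using P_condsD(3)[OF p, of \<beta>' \<eta>' z'] \<open>y \<subseteq> y'\<close> by auto
  qed (use that \<open>z \<subseteq> {..<\<beta>} \<inter> y'\<close> in auto)
  moreover have "Domain (insert ((\<beta>, \<eta>), z) f) \<subseteq> y' \<times> {..<\<kappa>}"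
    using p \<open>y \<subseteq> y'\<close> \<open>\<beta> \<in> y'\<close> \<open>\<eta> < \<kappa>\<close> by (auto simp: P_conds_def)
  ultimately show ?thesis
    using assms by (simp add: P_conds_def)
qed

text \<open>Injectivity keeps the moved function single-valued, and monotonicity keeps each value
  below its first coordinate.\<close>

lemma P_conds_action:
  fixes \<kappa> \<kappa>' :: "'o::wellorder"
  assumes p: "p \<in> P_conds \<kappa> \<kappa>'" and \<pi>: "strict_mono_on y \<pi>" "\<pi> ` y \<subseteq> {..<\<kappa>'}" "fst p \<subseteq> y"
  shows "action (P_triple \<kappa> \<kappa>') \<pi> p \<in> P_conds \<kappa> \<kappa>'"
proof -
  obtain x f where pf: "p = (x, f)"
    by fastforce
  let ?f = "{((\<pi> \<beta>, \<eta>), \<pi> ` z) | \<beta> \<eta> z. ((\<beta>, \<eta>), z) \<in> f}"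
  have inj: "inj_on \<pi> y"
    using \<pi>(1) by (rule strict_mono_on_imp_inj_on)
  have P: "|x| <o ord_rel \<kappa>" "single_valued f" "|f| <o ord_rel \<kappa>" "x \<subseteq> y"
    using p \<pi>(3) by (auto simp: P_conds_def pf)
  have dom: "\<beta> \<in> y" "\<beta> \<in> x" "\<eta> < \<kappa>" "z \<subseteq> {..<\<beta>} \<inter> x" if "((\<beta>, \<eta>), z) \<in> f" for \<beta> \<eta> z
    using P_condsD[OF p, of \<beta> \<eta> z] that P(4) by (auto simp: pf)
  have "?f = (\<lambda>((\<beta>, \<eta>), z). ((\<pi> \<beta>, \<eta>), \<pi> ` z)) ` f"
    by (force simp: image_iff)
  then have "|?f| <o ord_rel \<kappa>"
    using ordLeq_ordLess_trans[OF card_of_image P(3)] by simp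
  moreover have "|\<pi> ` x| <o ord_rel \<kappa>"
    using ordLeq_ordLess_trans[OF card_of_image P(1)] .
  moreover have "single_valued ?f"
  proof (rule single_valuedI)
    fix a b c assume "(a, b) \<in> ?f" "(a, c) \<in> ?f"
    then obtain \<beta> \<eta> z \<beta>' z' where "a = (\<pi> \<beta>, \<eta>)" "\<pi> \<beta> = \<pi> \<beta>'" "b = \<pi> ` z" "c = \<pi> ` z'"
      "((\<beta>, \<eta>), z) \<in> f" "((\<beta>', \<eta>), z') \<in> f"
      by blast
    moreover from this have "\<beta> = \<beta>'"
      using inj dom(1) by (meson inj_onD)
    ultimately show "b = c"
      using P(2) by (auto dest: single_valuedD)
  qed
  moreover have "w \<subseteq> {..<\<gamma>} \<inter> \<pi> ` x" if w: "((\<gamma>, \<eta>), w) \<in> ?f" for \<gamma> \<eta> w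
  proof -
    obtain \<beta> z where z: "\<gamma> = \<pi> \<beta>" "w = \<pi> ` z" "((\<beta>, \<eta>), z) \<in> f"
      using w by blast
    then show ?thesis
      using P(4) dom[OF z(3)] by (auto intro!: strict_mono_onD[OF \<pi>(1)])
  qed
  moreover have "\<pi> ` x \<subseteq> {..<\<kappa>'}"
    using \<pi>(2) P(4) by auto
  moreover have "Domain ?f \<subseteq> \<pi> ` x \<times> {..<\<kappa>}"
    using dom by auto
  ultimately show ?thesis
    by (simp add: P_triple_def P_conds_def pf)
qed

text \<open>The invariance required of a system. The action leaves the index \<eta> alone, so the
  bound \<xi> is unaffected, and \<pi> reflects both the maximum of \<open>x\<close> and the entry
  stored there.\<close>

lemma guess_action:
  fixes \<kappa> \<kappa>' :: "'o::wellorder"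
  assumes p: "p \<in> P_conds \<kappa> \<kappa>'" and \<pi>: "strict_mono_on y \<pi>" "\<pi> ` y \<subseteq> {..<\<kappa>'}"
    and sub: "x \<subseteq> fst p" "fst p \<subseteq> y"
  shows "p \<in> guess \<kappa> \<kappa>' \<xi> x \<longleftrightarrow> action (P_triple \<kappa> \<kappa>') \<pi> p \<in> guess \<kappa> \<kappa>' \<xi> (\<pi> ` x)"
proof -
  have inj: "inj_on \<pi> y"
    using \<pi>(1) by (rule strict_mono_on_imp_inj_on)
  have diff: "\<pi> ` x - {\<pi> \<beta>} = \<pi> ` (x - {\<beta>})" if "\<beta> \<in> x" for \<beta>
    using that sub inj_onD[OF inj] by blast
  have mx: "\<pi> ` x \<subseteq> {..\<pi> \<beta>} \<longleftrightarrow> x \<subseteq> {..\<beta>}" if "\<beta> \<in> x" for \<beta>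
    using that sub strict_mono_on_less_eq[OF \<pi>(1)] by (auto simp: subset_iff)
  have mem: "((\<pi> \<beta>, \<eta>), \<pi> ` (x - {\<beta>})) \<in> snd (action (P_triple \<kappa> \<kappa>') \<pi> p)
      \<longleftrightarrow> ((\<beta>, \<eta>), x - {\<beta>}) \<in> snd p" (is "?l = ?r") if "\<beta> \<in> x" for \<beta> \<eta>
  proof
    assume ?l
    then obtain \<beta>' z where *: "\<pi> \<beta> = \<pi> \<beta>'" "\<pi> ` (x - {\<beta>}) = \<pi> ` z" "((\<beta>', \<eta>), z) \<in> snd p"
      by (auto simp: P_triple_def)
    \<comment> \<open>Injectivity of \<pi> is known on \<open>y\<close> only, so everything compared
      has to lie in \<open>y\<close>.\<close>
    have "\<beta>' \<in> y" "\<beta> \<in> y" "z \<subseteq> y" "x - {\<beta>} \<subseteq> y"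
      using P_condsD[OF p *(3)] sub \<open>\<beta> \<in> x\<close> by auto
    then have "\<beta> = \<beta>'" "x - {\<beta>} = z"
      using *(1,2) inj_on_eq_iff[OF inj] inj_on_image_eq_iff[OF inj] by simp_all
    then show ?r
      using * by simp
  qed (auto simp: P_triple_def)
  have "fst (action (P_triple \<kappa> \<kappa>') \<pi> p) = \<pi> ` fst p"
    by (simp add: P_triple_def)
  then show ?thesis
    using p P_conds_action[OF p \<pi> sub(2)] sub(1)
    by (auto simp: guess_def diff mx mem)
qed

context
  fixes \<kappa> \<kappa>' \<rho> \<xi> :: "'o::wellorder" and x :: "'o set"
  assumes reg: "regular_uncountable \<kappa>" and rho: "\<rho> < \<kappa>" and xi: "\<xi> < \<kappa>"
    and x: "x \<in> coi_images \<kappa>' (osuc \<rho>)"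
begin

lemma coi_images_small: "x \<subseteq> {..<\<kappa>'}" "|x| <o ord_rel \<kappa>"
proof -
  obtain \<pi> where "x = \<pi> ` {..<osuc \<rho>}" "x \<subseteq> {..<\<kappa>'}"
    using x by (auto simp: coi_images_def)
  then show "x \<subseteq> {..<\<kappa>'}" "|x| <o ord_rel \<kappa>"
    using ordLeq_ordLess_trans[OF card_of_image card_of_initial_less[OF reg osuc_less_kappa[OF reg rho]]]
    by simp_all
qed

lemma coi_images_top: obtains \<beta> where "\<beta> \<in> x" "x \<subseteq> {..\<beta>}"
  by (rule coi_images_max[OF x rho])

text \<open>A condition with realm exactly \<open>x\<close> and a single entry, at index exactly
  \<xi>. The realm pins down the common realm; the index separates the systems for different
  \<xi>.\<close>

lemma guess_minimal:
  obtains \<beta> where "\<beta> \<in> x" "(x, {((\<beta>, \<xi>), x - {\<beta>})}) \<in> guess \<kappa> \<kappa>' \<xi> x"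
proof -
  obtain \<beta> where \<beta>: "\<beta> \<in> x" "x \<subseteq> {..\<beta>}"
    by (rule coi_images_top)
  have "(x, {}) \<in> P_conds \<kappa> \<kappa>'"
    using coi_images_small by (simp add: P_conds_def card_of_finite_less_kappa[OF reg])
  then have "(x, {((\<beta>, \<xi>), x - {\<beta>})}) \<in> P_conds \<kappa> \<kappa>'"
    by (rule P_conds_extend[OF reg]) (use coi_images_small \<beta> xi in \<open>auto simp: less_le\<close>)
  then show thesis
    using \<beta> that by (auto simp: guess_def)
qed

lemma common_realm_guess: "common_realm (P_triple \<kappa> \<kappa>') (guess \<kappa> \<kappa>' \<xi> x) = x"
proof -
  obtain \<beta> where "(x, {((\<beta>, \<xi>), x - {\<beta>})}) \<in> guess \<kappa> \<kappa>' \<xi> x"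
    by (rule guess_minimal)
  then show ?thesis
    by (force simp: common_realm_def P_triple_def guess_def)
qed

text \<open>A condition is extended by enlarging its realm to the prescribed closure, which is still
  small, and adding one entry at \<beta> with a fresh index. The new value is a subset of
  \<open>x\<close>, so it forces no further ordinals into the realm.\<close>

lemma sharply_dense_guess: "sharply_dense (P_triple \<kappa> \<kappa>') (guess \<kappa> \<kappa>' \<xi> x)"
proof -
  have "\<exists>q\<in>guess \<kappa> \<kappa>' \<xi> x. y \<subseteq> fst q \<and> f \<subseteq> snd q \<and> fst q = cl (y \<union> x)"
    if p: "(y, f) \<in> P_conds \<kappa> \<kappa>'" for y f
  proof -
    obtain \<beta> where \<beta>: "\<beta> \<in> x" "x \<subseteq> {..\<beta>}"
      by (rule coi_images_top)
    have "|Domain f| <o ord_rel \<kappa>"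
      using p card_of_image[of fst f] ordLeq_ordLess_trans by (auto simp: P_conds_def Domain_fst)
    \<comment> \<open>The index is chosen to differ from all indices that \<open>f\<close> uses at
      any first coordinate; these are fewer than \<kappa>.\<close>
    then have "|snd ` Domain f| <o ord_rel \<kappa>"
      using card_of_image ordLeq_ordLess_trans by blast
    then have "|{..<\<kappa>}| \<le>o |{\<xi>..<\<kappa>} - snd ` Domain f|"
      using tail_diff_large[OF reg xi] by blast
    then have "{\<xi>..<\<kappa>} - snd ` Domain f \<noteq> {}"
      using xi by (metis card_of_empty3 empty_iff lessThan_iff)
    then obtain \<eta> where "\<eta> \<in> {\<xi>..<\<kappa>} - snd ` Domain f"
      by blast
    then have \<eta>: "\<xi> \<le> \<eta>" "\<eta> < \<kappa>" "\<eta> \<notin> snd ` Domain f"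
      by simp_all
    have sup: "y \<union> x \<subseteq> cl (y \<union> x)"
      by (rule cl_superset)
    have "(cl (y \<union> x), insert ((\<beta>, \<eta>), x - {\<beta>}) f) \<in> P_conds \<kappa> \<kappa>'"
    proof (rule P_conds_extend[OF reg p])
      show "cl (y \<union> x) \<subseteq> {..<\<kappa>'}"
        using p coi_images_small by (intro cl_lessThan) (auto simp: P_conds_def)
      show "|cl (y \<union> x)| <o ord_rel \<kappa>"
        using p coi_images_small
        by (intro card_of_cl_less[OF reg] card_of_Un_less_kappa[OF reg]) (auto simp: P_conds_def)
      show "(\<beta>, \<eta>) \<notin> Domain f"
        using \<eta>(3) by force
    qed (use sup \<beta> \<eta> in \<open>auto simp: less_le\<close>)
    then have "(cl (y \<union> x), insert ((\<beta>, \<eta>), x - {\<beta>}) f) \<in> guess \<kappa> \<kappa>' \<xi> x"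
      using sup \<beta> \<eta> by (auto simp: guess_def)
    then show ?thesis
      using sup by (intro bexI) auto
  qed
  moreover have "guess \<kappa> \<kappa>' \<xi> x \<noteq> {}"
    using guess_minimal by blast
  moreover have "guess \<kappa> \<kappa>' \<xi> x \<subseteq> P_conds \<kappa> \<kappa>'"
    by (auto simp: guess_def)
  ultimately show ?thesis
    unfolding sharply_dense_def common_realm_guess by (force simp: P_triple_def)
qed

end

lemma sharply_dense_system_guess:
  fixes \<kappa> \<kappa>' \<rho> \<xi> :: "'o::wellorder"
  assumes "regular_uncountable \<kappa>" "\<rho> < \<kappa>" "\<xi> < \<kappa>"
  shows "sharply_dense_system \<kappa> \<kappa>' (P_triple \<kappa> \<kappa>') (guess \<kappa> \<kappa>' \<xi> ` coi_images \<kappa>' (osuc \<rho>))"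
proof -
  have "conds (P_triple \<kappa> \<kappa>') = P_conds \<kappa> \<kappa>'" "realm (P_triple \<kappa> \<kappa>') = fst"
    by (simp_all add: P_triple_def)
  then show ?thesis
    unfolding sharply_dense_system_def
    using osuc_less_kappa[OF assms(1,2)] sharply_dense_guess[OF assms] common_realm_guess[OF assms]
    by (intro exI[of _ "osuc \<rho>"] conjI exI[of _ "guess \<kappa> \<kappa>' \<xi>"] ballI allI impI)
      (auto simp: coi_def guess_action)
qed

text \<open>Ensures that the collection has exactly \<kappa> members. For \<xi> < \<xi>' the
  condition of \<open>guess_minimal\<close> has its only entry at \<xi>, so it lies in no member of
  the system for \<xi>'.\<close>

lemma inj_on_guess:
  fixes \<kappa> \<kappa>' \<rho> :: "'o::wellorder"
  assumes reg: "regular_uncountable \<kappa>" and rho: "\<rho> < \<kappa>" and "coi_images \<kappa>' (osuc \<rho>) \<noteq> {}"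
  shows "inj_on (\<lambda>\<xi>. guess \<kappa> \<kappa>' \<xi> ` coi_images \<kappa>' (osuc \<rho>)) {..<\<kappa>}"
proof -
  let ?S = "\<lambda>\<xi>. guess \<kappa> \<kappa>' \<xi> ` coi_images \<kappa>' (osuc \<rho>)"
  obtain x where x: "x \<in> coi_images \<kappa>' (osuc \<rho>)"
    using assms(3) by blast
  have neq: "?S \<xi> \<noteq> ?S \<xi>'" if "\<xi> < \<xi>'" "\<xi> < \<kappa>" for \<xi> \<xi>'
  proof
    assume "?S \<xi> = ?S \<xi>'"
    then obtain x' where "guess \<kappa> \<kappa>' \<xi> x = guess \<kappa> \<kappa>' \<xi>' x'"
      using x by blast
    moreover obtain \<beta> where "(x, {((\<beta>, \<xi>), x - {\<beta>})}) \<in> guess \<kappa> \<kappa>' \<xi> x"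
      by (rule guess_minimal[OF reg rho \<open>\<xi> < \<kappa>\<close> x])
    ultimately have "(x, {((\<beta>, \<xi>), x - {\<beta>})}) \<in> guess \<kappa> \<kappa>' \<xi>' x'"
      by simp
    then show False
      using \<open>\<xi> < \<xi>'\<close> by (auto simp: guess_def)
  qed
  show ?thesis
    by (rule inj_onI) (metis lessThan_iff linorder_neqE neq)
qed

section \<open>Bounding what a filter can meet, and the conclusion\<close>

text \<open>As \<open>G\<close> is directed, its conditions have compatible functions. Sending
  \<open>x\<close> to an index where \<open>x - {\<beta>}\<close> occurs at the shared maximum
  \<beta> is therefore injective.\<close>

lemma few_guessed:
  fixes \<kappa> \<kappa>' \<xi> :: "'o::wellorder"
  assumes G: "filter_on (P_triple \<kappa> \<kappa>') G"
    and meets: "\<And>x. x \<in> X \<Longrightarrow> G \<inter> guess \<kappa> \<kappa>' \<xi> x \<noteq> {}"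
    and top: "\<And>x. x \<in> X \<Longrightarrow> \<beta> \<in> x \<and> x \<subseteq> {..\<beta>}"
  shows "|X| \<le>o |{..<\<kappa>}|"
proof -
  have GP: "G \<subseteq> P_conds \<kappa> \<kappa>'"
    using G by (simp add: filter_on_def P_triple_def)
  have "\<exists>\<eta><\<kappa>. \<exists>p\<in>G. ((\<beta>, \<eta>), x - {\<beta>}) \<in> snd p" if "x \<in> X" for x
  proof -
    obtain p \<beta>' \<eta> where "p \<in> G" "\<beta>' \<in> x" "x \<subseteq> {..\<beta>'}" and f: "((\<beta>', \<eta>), x - {\<beta>'}) \<in> snd p"
      using meets[OF \<open>x \<in> X\<close>] by (auto simp: guess_def)
    moreover have "\<beta>' = \<beta>"
      using top[OF \<open>x \<in> X\<close>] \<open>\<beta>' \<in> x\<close> \<open>x \<subseteq> {..\<beta>'}\<close> by (meson antisym atMost_iff subsetD)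
    moreover have "\<eta> < \<kappa>"
      using GP \<open>p \<in> G\<close> P_condsD(2)[OF _ f] by blast
    ultimately show ?thesis
      by blast
  qed
  then obtain e where e: "\<And>x. x \<in> X \<Longrightarrow> e x < \<kappa> \<and> (\<exists>p\<in>G. ((\<beta>, e x), x - {\<beta>}) \<in> snd p)"
    by metis
  have "inj_on e X"
  proof (rule inj_onI)
    fix x x' assume X: "x \<in> X" "x' \<in> X" and eq: "e x = e x'"
    obtain p p' where p: "p \<in> G" "p' \<in> G"
      "((\<beta>, e x), x - {\<beta>}) \<in> snd p" "((\<beta>, e x), x' - {\<beta>}) \<in> snd p'"
      using e[OF X(1)] e[OF X(2)] eq by auto
    \<comment> \<open>A common extension in \<open>G\<close> contains both entries, and its function
      has only one value at that place.\<close>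
    obtain r where "r \<in> G" "le (P_triple \<kappa> \<kappa>') r p" "le (P_triple \<kappa> \<kappa>') r p'"
      using G p(1,2) unfolding filter_on_def by blast
    then have "r \<in> G" "snd p \<subseteq> snd r" "snd p' \<subseteq> snd r"
      by (simp_all add: P_triple_def)
    moreover have "single_valued (snd r)"
      using GP \<open>r \<in> G\<close> by (auto simp: P_conds_def)
    ultimately have "x - {\<beta>} = x' - {\<beta>}"
      using p(3,4) by (meson single_valuedD subsetD)
    then show "x = x'"
      using top[OF X(1)] top[OF X(2)] by blast
  qed
  then show ?thesis
    using e by (intro card_of_ordLeqI[of e]) auto
qed

theorem theorem3p8:
  fixes \<kappa> \<kappa>' :: "'o::wellorder"
  assumes "regular_uncountable \<kappa>"
    and "is_succ_card \<kappa>' \<kappa>"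
    and "ord_rel \<kappa> <o |short_seqs \<kappa>|"
  shows "\<exists>C :: 'o cond set set set.
           |C| =o ord_rel \<kappa> \<and>
           (\<forall>S \<in> C. sharply_dense_system \<kappa> \<kappa>' (P_triple \<kappa> \<kappa>') S) \<and>
           \<not> (\<exists>G. filter_on (P_triple \<kappa> \<kappa>') G \<and> (\<forall>S \<in> C. meets_everywhere G S))"
proof -
  note reg = assms(1)
  have card: "|{..<\<kappa>}| =o ord_rel \<kappa>"
    by (rule card_of_lessThan[OF Card_order_kappa[OF reg]])
  \<comment> \<open>This makes \<kappa> available as the top point of subsets of \<kappa>'.\<close>
  have "\<kappa> < \<kappa>'"
  proof (rule ccontr)
    assume "\<not> \<kappa> < \<kappa>'"
    then have "|{..<\<kappa>'}| \<le>o |{..<\<kappa>}|"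
      by (intro card_of_mono1) auto
    moreover have succ: "ord_rel \<kappa>' =o cardSuc (ord_rel \<kappa>)"
      using assms(2) by (simp add: is_succ_card_def)
    then have "Card_order (ord_rel \<kappa>')"
      using Card_order_ordIso cardSuc_Card_order Card_order_kappa[OF reg] by blast
    then have "|{..<\<kappa>'}| =o ord_rel \<kappa>'"
      by (rule card_of_lessThan)
    ultimately have "cardSuc (ord_rel \<kappa>) \<le>o ord_rel \<kappa>"
      using succ card by (meson ordIso_ordLeq_trans ordIso_symmetric ordLeq_ordIso_trans)
    then show False
      using cardSuc_greater[OF Card_order_kappa[OF reg]] not_ordLess_ordLeq by blast
  qed
  obtain \<rho> where \<rho>: "\<rho> < \<kappa>"
    and seqs: "ord_rel \<kappa> <o |{s :: 'o \<rightharpoonup> 'o. dom s = {..<\<rho>} \<and> ran s \<subseteq> {..<\<kappa>}}|"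
    using exists_long_seqs[OF reg assms(3)] by blast
  \<comment> \<open>Decoding a sequence of length \<rho> takes the values at positions 0 to \<rho>;
    the top point \<kappa> comes at position \<rho> + 1.\<close>
  define \<theta> where "\<theta> = osuc (osuc \<rho>)"
  have \<rho>1: "osuc \<rho> < \<kappa>"
    by (rule osuc_less_kappa[OF reg \<rho>])
  define X where "X = {x \<in> coi_images \<kappa>' \<theta>. \<kappa> \<in> x \<and> x \<subseteq> {..\<kappa>}}"
  have X: "ord_rel \<kappa> <o |X|"
    using seqs many_closed_sets[OF reg \<open>\<kappa> < \<kappa>'\<close> \<rho>] ordLess_ordLeq_trans
    unfolding X_def \<theta>_def by blast
  then have "X \<noteq> {}"
    using card_of_empty ordLess_ordLeq_trans ordLess_irreflexive
    by (metis Well_order_ord_rel card_of_empty1 not_ordLess_ordLeq)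
  then have ne: "coi_images \<kappa>' \<theta> \<noteq> {}"
    by (auto simp: X_def)
  define C where "C = (\<lambda>\<xi>. guess \<kappa> \<kappa>' \<xi> ` coi_images \<kappa>' \<theta>) ` {..<\<kappa>}"
  have "|C| =o |{..<\<kappa>}|"
    using inj_on_guess[OF reg \<rho>1 ne[unfolded \<theta>_def]]
    unfolding C_def \<theta>_def by (meson card_of_ordIsoI inj_on_imp_bij_betw ordIso_symmetric)
  then have "|C| =o ord_rel \<kappa>"
    using card ordIso_transitive by blast
  moreover have "\<forall>S\<in>C. sharply_dense_system \<kappa> \<kappa>' (P_triple \<kappa> \<kappa>') S"
    unfolding C_def \<theta>_def using sharply_dense_system_guess[OF reg \<rho>1] by blast
  moreover have False
    if G: "filter_on (P_triple \<kappa> \<kappa>') G" "\<forall>S\<in>C. meets_everywhere G S" for G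
  proof -
    \<comment> \<open>Here \<rho> serves merely as an ordinal below \<kappa>, to pick one system of
      \<open>C\<close>.\<close>
    have "guess \<kappa> \<kappa>' \<rho> ` coi_images \<kappa>' \<theta> \<in> C"
      using \<rho> by (simp add: C_def)
    then have "G \<inter> guess \<kappa> \<kappa>' \<rho> x \<noteq> {}" if "x \<in> X" for x
      using G(2) that by (auto simp: meets_everywhere_def X_def)
    then have "|X| \<le>o |{..<\<kappa>}|"
      by (rule few_guessed[OF G(1), where \<beta> = \<kappa>]) (auto simp: X_def)
    then show False
      using X card by (meson not_ordLess_ordLeq ordLeq_ordIso_trans)
  qed
  ultimately show ?thesis
    by blast
qed

end
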